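(* Let $f_1,\dots,f_n:\mathbb{R}^p\to\mathbb{R}$ be differentiable functions such that, for every $i$ and all $x,y\in\mathbb{R}^p$, $$\|\nabla f_i(x)-\nabla f_i(y)\|\le L_i\|x-y\|,\qquad f_i(x)\ge f_i(y)+\langle\nabla f_i(y),x-y\rangle+\tfrac{\mu_i}{2}\|x-y\|^2,$$ with $L_i\in(0,\infty)$, $\mu_i\in[0,\infty)$, and at least one $\mu_i>0$. Put $L=\max_iL_i$, $\bar\mu=\frac1n\sum_{i=1}^n\mu_i$, $\bar\kappa=L/\bar\mu$, and let $x^*$ be the unique minimizer of $f=\frac1n\sum_{i=1}^nf_i$. Let $\mathcal{E}(0),\mathcal{E}(1),\dots$ be the edge sets of a sequence of undirected graphs on $\{1,\dots,n\}$ and let $\mathbf{W}(k)=[W_{ij}(k)]\in\mathbb{R}^{n\times n}$, $k=0,1,\dots$, satisfy: (i) $W_{ij}(k)=0$ whenever $i\ne j$ and $(j,i)\notin\mathcal{E}(k)$; (ii) $\mathbf{W}(k)$ is doubly stochastic (nonnegative entries, $\mathbf{W}(k)\mathbf{1}=\mathbf{1}$, $\mathbf{1}^\top\mathbf{W}(k)=\mathbf{1}^\top$); (iii) there is a positive integer $B$ such that $$\delta:=\sup_{k\ge B-1}\sigma_{\max}\Big\{\mathbf{W}(k)\mathbf{W}(k-1)\cdots\mathbf{W}(k-B+1)-\tfrac1n\mathbf{1}\mathbf{1}^\top\Big\}<1.$$ Let $$J_1=3\bar\kappa B^2\left(1+4\sqrt{n}\sqrt{\bar\kappa}\right).$$ Then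 for any step-size $\alpha\in\left(0,\frac{1.5(1-\delta)^2}{\bar\mu J_1}\right]$ and any initial $\mathbf{x}(0)\in\mathbb{R}^{n\times p}$, the sequence $\{\mathbf{x}(k)\}$ generated by the DIGing algorithm converges to $\mathbf{x}^*=\mathbf{1}(x^* )^\top$ at the global geometric rate $O(\lambda^k)$, i.e. there is a constant $C$ with $\|\mathbf{x}(k)-\mathbf{x}^*\|_F\le C\lambda^k$ for all $k\ge0$, where $$\lambda=\begin{cases}\sqrt[2B]{1-\frac{\alpha\bar\mu}{1.5}}, & \text{if } \alpha\in\left(0,\frac{1.5\left(\sqrt{J_1^2+(1-\delta^2)J_1}-\delta J_1\right)^2}{\bar\mu J_1(J_1+1)^2}\right],\\[2mm] \sqrt[B]{\sqrt{\frac{\alpha\bar\mu J_1}{1.5}}+\delta}, & \text{if } \alpha\in\left(\frac{1.5\left(\sqrt{J_1^2+(1-\delta^2)J_1}-\delta J_1\right)^2}{\bar\mu J_1(J_1+1)^2},\frac{1.5(1-\delta)^2}{\bar\mu J_1}\right].\end{cases}$$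
   Context: $\mathbf{1}$ is the all-ones column vector in $\mathbb{R}^n$, $\|\cdot\|_F$ the Frobenius norm (Euclidean norm $\|\cdot\|$ on vectors), $\sigma_{\max}$ the largest singular value. For $\mathbf{x}\in\mathbb{R}^{n\times p}$ with rows $x_1^\top,\dots,x_n^\top$, $\nabla\mathbf{f}(\mathbf{x})\in\mathbb{R}^{n\times p}$ denotes the matrix whose $i$-th row is $(\nabla f_i(x_i))^\top$. DIGing algorithm: with step-size $\alpha>0$, arbitrary $\mathbf{x}(0)\in\mathbb{R}^{n\times p}$ and $\mathbf{y}(0)=\nabla\mathbf{f}(\mathbf{x}(0))$, for $k=0,1,\dots$ $$\mathbf{x}(k+1)=\mathbf{W}(k)\mathbf{x}(k)-\alpha\mathbf{y}(k),\qquad \mathbf{y}(k+1)=\mathbf{W}(k)\mathbf{y}(k)+\nabla\mathbf{f}(\mathbf{x}(k+1))-\nabla\mathbf{f}(\mathbf{x}(k)).$$ *)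

theory Defs
  imports "HOL-Analysis.Analysis"
begin

text \<open>
  Agents are the elements of a finite type \<open>'n\<close>, so \<open>n = CARD('n)\<close>; similarly \<open>p = CARD('p)\<close>.
  A matrix in \<open>R^(n x p)\<close> has type \<open>real ^ 'p ^ 'n\<close>, where \<open>x $ i\<close> is the \<open>i\<close>-th row; the library
  norm of this type is the Euclidean norm of the vector of Euclidean norms of the rows,
  i.e. the Frobenius norm.
\<close>

text \<open>The gradient; meaningful where \<open>f\<close> is differentiable, since there it is unique.\<close>

definition grad :: "('a::euclidean_space \<Rightarrow> real) \<Rightarrow> 'a \<Rightarrow> 'a" where
  "grad f x = (THE d. GDERIV f x :> d)"

definition stacked_grad :: "('n \<Rightarrow> real ^ 'p \<Rightarrow> real) \<Rightarrow> real ^ 'p ^ 'n \<Rightarrow> real ^ 'p ^ 'n" where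
  "stacked_grad f x = (\<chi> i. grad (f i) (x $ i))"

definition avg_fun :: "('n::finite \<Rightarrow> 'a \<Rightarrow> real) \<Rightarrow> 'a \<Rightarrow> real" where
  "avg_fun f x = (1 / real CARD('n)) * (\<Sum>i\<in>UNIV. f i x)"

definition singular_values :: "real ^ 'n ^ 'm \<Rightarrow> real set" where
  "singular_values A =
     {sqrt l |l. \<exists>v. v \<noteq> 0 \<and> (transpose A ** A) *v v = l *\<^sub>R v}"

definition sigma_max :: "real ^ 'n ^ 'm \<Rightarrow> real" where
  "sigma_max A = Max (singular_values A)"

text \<open>Here \<open>1\<close> is the all-ones vector of \<open>real ^ 'n\<close>.\<close>

definition doubly_stochastic :: "real ^ 'n ^ 'n \<Rightarrow> bool" where
  "doubly_stochastic A \<longleftrightarrow> (\<forall>i j. 0 \<le> A $ i $ j) \<and> A *v 1 = 1 \<and> 1 v* A = 1"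

text \<open>\<open>1/n\<close> times the product of the all-ones column vector and the all-ones row vector.\<close>

definition averaging_matrix :: "real ^ 'n ^ 'n" where
  "averaging_matrix = (\<chi> i j. 1 / real CARD('n))"

text \<open>
  \<open>back_prod W b k = W k ** W (k - 1) ** \<dots> ** W (k - b + 1)\<close>, with \<open>b\<close> factors. The truncated
  subtraction is harmless as long as \<open>b \<le> k + 1\<close>.
\<close>

primrec back_prod :: "(nat \<Rightarrow> real ^ 'n ^ 'n) \<Rightarrow> nat \<Rightarrow> nat \<Rightarrow> real ^ 'n ^ 'n" where
  "back_prod W 0 k = mat 1"
| "back_prod W (Suc b) k = back_prod W b k ** W (k - b)"

definition diging ::
  "('n \<Rightarrow> real ^ 'p \<Rightarrow> real) \<Rightarrow> (nat \<Rightarrow> real ^ 'n ^ 'n) \<Rightarrow> real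
     \<Rightarrow> (nat \<Rightarrow> real ^ 'p ^ 'n) \<Rightarrow> (nat \<Rightarrow> real ^ 'p ^ 'n) \<Rightarrow> bool" where
  "diging f W \<alpha> x y \<longleftrightarrow>
     y 0 = stacked_grad f (x 0) \<and>
     (\<forall>k. x (Suc k) = W k ** x k - \<alpha> *\<^sub>R y k) \<and>
     (\<forall>k. y (Suc k) = W k ** y k + stacked_grad f (x (Suc k)) - stacked_grad f (x k))"

definition diging_threshold :: "real \<Rightarrow> real \<Rightarrow> real \<Rightarrow> real" where
  "diging_threshold mubar \<delta> J1 =
     1.5 * (sqrt (J1\<^sup>2 + (1 - \<delta>\<^sup>2) * J1) - \<delta> * J1)\<^sup>2 / (mubar * J1 * (J1 + 1)\<^sup>2)"

definition diging_rate :: "nat \<Rightarrow> real \<Rightarrow> real \<Rightarrow> real \<Rightarrow> real \<Rightarrow> real" where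
  "diging_rate B mubar \<delta> J1 \<alpha> =
     (if \<alpha> \<le> diging_threshold mubar \<delta> J1
      then root (2 * B) (1 - \<alpha> * mubar / 1.5)
      else root B (sqrt (\<alpha> * mubar * J1 / 1.5) + \<delta>))"

end

theory Submission
  imports Defs
begin

text \<open>
  Split the iterates into row means and deviations from them. Over \<open>B\<close> steps the mixing matrices
  contract deviations by \<open>\<delta>\<close>, so the deviations of \<open>x\<close> are controlled by those of \<open>y\<close>, and the
  deviations of \<open>y\<close> by the increments of the gradients, that is, by the distances of \<open>x k\<close> and
  \<open>x (k + 1)\<close> to the optimum. The row mean of \<open>y\<close> tracks the averaged gradient, so the row mean
  of \<open>x\<close> performs gradient descent on the average function with an error controlled by the
  deviation of \<open>x\<close>. The step-size makes the gain of this loop at most 1 at the scale \<open>\<lambda> ^ k\<close>,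
  so one induction establishes all three geometric bounds simultaneously.
\<close>

subsection \<open>The largest singular value\<close>

lemma row_matrix_mult:
  fixes A :: "real ^ 'n ^ 'm" and v :: "real ^ 'p ^ 'n"
  shows "(A ** v) $ i = (\<Sum>j\<in>UNIV. A $ i $ j *\<^sub>R v $ j)"
  by (simp add: vec_eq_iff matrix_matrix_mult_def)

lemma column_matrix_mult:
  fixes A :: "real ^ 'n ^ 'm" and v :: "real ^ 'p ^ 'n"
  shows "column j (A ** v) = A *v column j v"
  by (simp add: vec_eq_iff matrix_matrix_mult_def matrix_vector_mult_def column_def)

lemma norm_matrix_columns:
  fixes v :: "real ^ 'p ^ 'n"
  shows "(norm v)\<^sup>2 = (\<Sum>j\<in>UNIV. (norm (column j v))\<^sup>2)"
proof -
  have "(norm v)\<^sup>2 = (\<Sum>i\<in>UNIV. \<Sum>j\<in>UNIV. v $ i $ j * v $ i $ j)"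
    by (simp add: power2_norm_eq_inner inner_vec_def)
  also have "\<dots> = (\<Sum>j\<in>UNIV. \<Sum>i\<in>UNIV. v $ i $ j * v $ i $ j)"
    by (rule sum.swap)
  finally show ?thesis
    by (simp add: power2_norm_eq_inner inner_vec_def column_def)
qed

lemma norm_squared_cart:
  fixes u :: "real ^ 'n"
  shows "(norm u)\<^sup>2 = (\<Sum>i\<in>UNIV. (u $ i)\<^sup>2)"
  by (simp add: norm_vec_def L2_set_def sum_nonneg)

text \<open>The squared Frobenius norm is a sum over columns and \<open>A\<close> acts on each
  column separately, so a bound on vectors carries over to matrices with the same constant.\<close>

lemma norm_matrix_mult_le:
  fixes A :: "real ^ 'n ^ 'm" and v :: "real ^ 'p ^ 'n"
  assumes "\<And>u. norm (A *v u) \<le> c * norm u" and "0 \<le> c"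
  shows "norm (A ** v) \<le> c * norm v"
proof (rule power2_le_imp_le)
  have "(norm (A ** v))\<^sup>2 = (\<Sum>j\<in>UNIV. (norm (A *v column j v))\<^sup>2)"
    by (simp add: norm_matrix_columns column_matrix_mult)
  also have "\<dots> \<le> (\<Sum>j\<in>UNIV. (c * norm (column j v))\<^sup>2)"
    using assms by (intro sum_mono power_mono) auto
  also have "\<dots> = (c * norm v)\<^sup>2"
    by (simp add: norm_matrix_columns power_mult_distrib sum_distrib_left)
  finally show "(norm (A ** v))\<^sup>2 \<le> (c * norm v)\<^sup>2" .
qed (use assms in auto)

lemma inner_gram:
  fixes A :: "real ^ 'n ^ 'm"
  shows "((transpose A ** A) *v u) \<bullet> v = (A *v u) \<bullet> (A *v v)"
proof -
  have "(transpose A ** A) *v u = (A *v u) v* A"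
    by (simp flip: matrix_vector_mul_assoc)
  then show ?thesis by (simp add: dot_lmul_matrix)
qed

text \<open>Eigenvectors of the symmetric matrix \<open>A\<^sup>T A\<close> for different
  eigenvalues are orthogonal, so one eigenvector per eigenvalue forms an independent, hence finite
  set. Finiteness makes the \<open>Max\<close> in \<open>sigma_max\<close> meaningful.\<close>

lemma finite_singular_values:
  fixes A :: "real ^ 'n ^ 'm"
  shows "finite (singular_values A)"
proof -
  let ?T = "transpose A ** A"
  define Ev where "Ev = {l. \<exists>v. v \<noteq> 0 \<and> ?T *v v = l *\<^sub>R v}"
  have "\<forall>l\<in>Ev. \<exists>v. v \<noteq> 0 \<and> ?T *v v = l *\<^sub>R v" by (simp add: Ev_def)
  then obtain e where e: "\<And>l. l \<in> Ev \<Longrightarrow> e l \<noteq> 0 \<and> ?T *v e l = l *\<^sub>R e l"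
    by (auto simp: bchoice_iff)
  have inj: "inj_on e Ev"
  proof (rule inj_onI)
    fix l k assume "l \<in> Ev" "k \<in> Ev" "e l = e k"
    then have "l *\<^sub>R e l = k *\<^sub>R e l" "e l \<noteq> 0" using e by metis+
    then show "l = k" by simp
  qed
  have "orthogonal (e l) (e k)" if "l \<in> Ev" "k \<in> Ev" "e l \<noteq> e k" for l k
  proof -
    have "(?T *v e l) \<bullet> e k = (?T *v e k) \<bullet> e l"
      unfolding inner_gram by (rule inner_commute)
    then have "(l - k) * (e l \<bullet> e k) = 0"
      using that e by (simp add: inner_commute algebra_simps)
    then show ?thesis using that by (auto simp: orthogonal_def)
  qed
  then have "pairwise orthogonal (e ` Ev)"
    by (auto simp: pairwise_def)
  moreover have "0 \<notin> e ` Ev" using e by force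
  ultimately have "finite (e ` Ev)"
    using pairwise_orthogonal_independent independent_imp_finite by blast
  then have "finite Ev" using inj finite_imageD by blast
  moreover have "singular_values A = sqrt ` Ev"
    by (auto simp: singular_values_def Ev_def)
  ultimately show ?thesis by simp
qed

text \<open>A maximiser of the Rayleigh quotient of \<open>A\<^sup>T A\<close> is an eigenvector.\<close>

lemma ex_dominating_singular_value:
  fixes A :: "real ^ 'n ^ 'm"
  shows "\<exists>s\<in>singular_values A. 0 \<le> s \<and> (\<forall>u. norm (A *v u) \<le> s * norm u)"
proof -
  let ?T = "transpose A ** A"
  have "sphere (0::real^'n) 1 \<noteq> {}" by auto
  moreover have "continuous_on (sphere 0 1) (\<lambda>v. norm (A *v v))"
    by (intro continuous_intros linear_continuous_on matrix_vector_mul_bounded_linear)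
  ultimately obtain v where v: "norm v = 1" "\<And>u. norm u = 1 \<Longrightarrow> norm (A *v u) \<le> norm (A *v v)"
    using continuous_attains_sup [of "sphere (0::real^'n) 1" "\<lambda>v. norm (A *v v)"]
    by (force simp: dist_norm)
  define s where "s = norm (A *v v)"
  have s0: "0 \<le> s" by (simp add: s_def)
  have bound: "norm (A *v u) \<le> s * norm u" for u
  proof (cases "u = 0")
    case False
    have "norm (A *v u) = norm u * norm (A *v (u /\<^sub>R norm u))"
      using False by (simp add: matrix_vector_mult_scaleR)
    also have "\<dots> \<le> norm u * s"
      using v(2) [of "u /\<^sub>R norm u"] False by (intro mult_left_mono) (auto simp: s_def)
    finally show ?thesis by (simp add: mult.commute)
  qed simp
  \<comment> \<open>\<open>g\<close> is half the gradient at \<open>v\<close> of the form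
    \<open>s\<^sup>2 * (norm u)\<^sup>2 - (norm (A *v u))\<^sup>2\<close> in \<open>u\<close>, which
    is nonnegative and vanishes at \<open>v\<close>. Moving from \<open>v\<close> by
    \<open>- t *\<^sub>R g\<close> would make it negative unless \<open>g = 0\<close>; this
    \<open>t\<close> gives \<open>t * s\<^sup>2 < 2\<close> even for \<open>s = 0\<close>.\<close>
  define g where "g = s\<^sup>2 *\<^sub>R v - ?T *v v"
  define t where "t = 1 / (s\<^sup>2 + 1)"
  have e1: "(norm (A *v (v - t *\<^sub>R g)))\<^sup>2 \<le> (s * norm (v - t *\<^sub>R g))\<^sup>2"
    using bound by (intro power_mono) auto
  have e2: "(norm (A *v (v - t *\<^sub>R g)))\<^sup>2 = s\<^sup>2 - 2 * t * ((A *v v) \<bullet> (A *v g)) + t\<^sup>2 * (norm (A *v g))\<^sup>2"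
    unfolding matrix_vector_mult_diff_distrib matrix_vector_mult_scaleR s_def power2_norm_eq_inner
    by (simp add: inner_commute algebra_simps power2_eq_square)
  have e3: "(s * norm (v - t *\<^sub>R g))\<^sup>2 = s\<^sup>2 * (1 - 2 * t * (v \<bullet> g) + t\<^sup>2 * (norm g)\<^sup>2)"
    using v(1) unfolding power_mult_distrib power2_norm_eq_inner norm_eq_1
    by (simp add: inner_commute algebra_simps power2_eq_square)
  have e4: "s\<^sup>2 * (v \<bullet> g) - (A *v v) \<bullet> (A *v g) = (norm g)\<^sup>2"
    unfolding inner_gram [symmetric] by (simp add: g_def power2_norm_eq_inner inner_diff_left)
  have "2 * t * (s\<^sup>2 * (v \<bullet> g) - (A *v v) \<bullet> (A *v g)) = 2 * t * (norm g)\<^sup>2"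
    by (simp only: e4)
  then have "0 \<le> t\<^sup>2 * (s\<^sup>2 * (norm g)\<^sup>2) - t\<^sup>2 * (norm (A *v g))\<^sup>2 - 2 * t * (norm g)\<^sup>2"
    using e1 unfolding e2 e3 by (simp add: algebra_simps)
  also have "\<dots> \<le> t * (norm g)\<^sup>2 * (t * s\<^sup>2 - 2)"
    using zero_le_power2 [of "t * norm (A *v g)"] by (simp add: algebra_simps power2_eq_square)
  finally have le: "0 \<le> t * (norm g)\<^sup>2 * (t * s\<^sup>2 - 2)" .
  have "t > 0" "t * s\<^sup>2 - 2 < 0"
    by (auto simp: t_def field_simps add_pos_nonneg add_nonneg_pos)
  then have "norm g = 0"
    using le by (auto simp: zero_le_mult_iff mult_le_0_iff)
  then have "?T *v v = s\<^sup>2 *\<^sub>R v" by (simp add: g_def)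
  then have "s \<in> singular_values A"
    unfolding singular_values_def using v(1) s0 by (auto intro!: exI [of _ "s\<^sup>2"] exI [of _ v])
  then show ?thesis using s0 bound by blast
qed

lemma norm_le_sigma_max:
  fixes A :: "real ^ 'n ^ 'm"
  shows "norm (A *v u) \<le> sigma_max A * norm u"
proof -
  obtain s where s: "s \<in> singular_values A" "\<And>u. norm (A *v u) \<le> s * norm u"
    using ex_dominating_singular_value by blast
  have "s \<le> sigma_max A"
    unfolding sigma_max_def using s(1) finite_singular_values [of A] by (simp add: Max_ge)
  then show ?thesis using s(2) [of u] by (meson mult_right_mono norm_ge_zero order_trans)
qed

lemma sigma_max_nonneg: "0 \<le> sigma_max (A :: real ^ 'n ^ 'm)"
  using norm_le_sigma_max [of A "1"] norm_ge_zero [of "A *v 1"]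
  by (smt (verit, best) mult_neg_pos zero_less_norm_iff zero_neq_one)

text \<open>At an eigenvector the stretching factor of \<open>A\<close> is exactly the singular
  value, so each singular value obeys any operator bound. This serves to bound the set whose
  supremum is \<delta>.\<close>

lemma sigma_max_le:
  fixes A :: "real ^ 'n ^ 'm"
  assumes "\<And>u. norm (A *v u) \<le> c * norm u" and "0 \<le> c"
  shows "sigma_max A \<le> c"
proof -
  have "s \<le> c" if s: "s \<in> singular_values A" for s
  proof -
    obtain l v where lv: "s = sqrt l" "v \<noteq> 0" "(transpose A ** A) *v v = l *\<^sub>R v"
      using s by (auto simp: singular_values_def)
    have "l * (norm v)\<^sup>2 = (norm (A *v v))\<^sup>2"
      using inner_gram [of A v v] lv(3) by (simp add: power2_norm_eq_inner)
    also have "\<dots> \<le> (c * norm v)\<^sup>2" using assms by (intro power_mono) auto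
    finally have "l \<le> c\<^sup>2" using lv(2) by (simp add: power_mult_distrib)
    then show ?thesis using lv(1) assms(2) real_le_lsqrt by blast
  qed
  moreover have "singular_values A \<noteq> {}" using ex_dominating_singular_value by blast
  ultimately show ?thesis
    unfolding sigma_max_def using finite_singular_values by (intro Max.boundedI) auto
qed

subsection \<open>Doubly stochastic mixing\<close>

definition row_mean :: "'a::real_vector ^ 'n \<Rightarrow> 'a" where
  "row_mean v = (1 / real CARD('n)) *\<^sub>R (\<Sum>i\<in>UNIV. v $ i)"

text \<open>Multiplication by \<open>I - (1/n) 1 1\<^sup>T\<close>, the projection onto stacks with
  zero row mean along the constant stacks.\<close>

definition deviation :: "'a::real_vector ^ 'n \<Rightarrow> 'a ^ 'n" where
  "deviation v = v - (\<chi> i. row_mean v)"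

lemma row_mean_add: "row_mean (u + v) = row_mean u + row_mean v"
  and row_mean_diff: "row_mean (u - v) = row_mean u - row_mean v"
  and row_mean_scaleR: "row_mean (c *\<^sub>R u) = c *\<^sub>R row_mean u"
  by (simp_all add: row_mean_def sum.distrib sum_subtractf scaleR_right.sum scaleR_add_right
      scaleR_diff_right mult.commute)

lemma row_mean_const [simp]: "row_mean (\<chi> i. c) = c"
  by (simp add: row_mean_def sum_constant_scaleR)

lemma deviation_add: "deviation (u + v) = deviation u + deviation v"
  and deviation_scaleR: "deviation (c *\<^sub>R u) = c *\<^sub>R deviation u"
  by (simp_all add: deviation_def vec_eq_iff row_mean_add row_mean_scaleR scaleR_diff_right)

lemma row_mean_deviation: "row_mean (deviation v) = 0"
  by (simp add: deviation_def row_mean_diff)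

lemma norm_const_rows:
  fixes c :: "'a::real_inner"
  shows "norm ((\<chi> i. c) :: 'a ^ 'n) = sqrt (real CARD('n)) * norm c"
  by (simp add: norm_vec_def L2_set_def real_sqrt_mult)

text \<open>Pythagoras: \<open>v\<close> is the sum of its deviation and an orthogonal stack of
  constant rows.\<close>

lemma norm_squared_deviation:
  fixes v :: "'a::real_inner ^ 'n"
  shows "(norm (deviation v))\<^sup>2 = (norm v)\<^sup>2 - real CARD('n) * (norm (row_mean v))\<^sup>2"
proof -
  have "(norm (deviation v))\<^sup>2
      = (\<Sum>i\<in>UNIV. v $ i \<bullet> v $ i - 2 * (v $ i \<bullet> row_mean v) + row_mean v \<bullet> row_mean v)"
    by (simp add: deviation_def power2_norm_eq_inner inner_vec_def inner_commute algebra_simps)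
  also have "\<dots> = (norm v)\<^sup>2 - 2 * ((\<Sum>i\<in>UNIV. v $ i) \<bullet> row_mean v)
      + real CARD('n) * (norm (row_mean v))\<^sup>2"
    by (simp add: power2_norm_eq_inner inner_vec_def inner_sum_left sum_subtractf sum.distrib
        sum_distrib_left)
  finally have "(norm (deviation v))\<^sup>2 = (norm v)\<^sup>2
      - 2 * ((\<Sum>i\<in>UNIV. v $ i) \<bullet> row_mean v) + real CARD('n) * (norm (row_mean v))\<^sup>2" .
  moreover have "(\<Sum>i\<in>UNIV. v $ i) = real CARD('n) *\<^sub>R row_mean v"
    by (simp add: row_mean_def)
  ultimately show ?thesis
    by (simp add: power2_norm_eq_inner)
qed

lemma norm_deviation_le:
  fixes v :: "'a::real_inner ^ 'n"
  shows "norm (deviation v) \<le> norm v"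
  by (rule power2_le_imp_le) (simp_all add: norm_squared_deviation)

lemma doubly_stochastic_nonneg: "doubly_stochastic A \<Longrightarrow> 0 \<le> A $ i $ j"
  by (simp add: doubly_stochastic_def)

lemma doubly_stochastic_row_sum:
  fixes A :: "real ^ 'n ^ 'n"
  assumes "doubly_stochastic A" shows "(\<Sum>j\<in>UNIV. A $ i $ j) = 1"
proof -
  have "(A *v 1) $ i = 1" using assms by (simp add: doubly_stochastic_def)
  then show ?thesis by (simp add: matrix_vector_mult_def)
qed

lemma doubly_stochastic_col_sum:
  fixes A :: "real ^ 'n ^ 'n"
  assumes "doubly_stochastic A" shows "(\<Sum>i\<in>UNIV. A $ i $ j) = 1"
proof -
  have "(1 v* A) $ j = 1" using assms by (simp add: doubly_stochastic_def)
  then show ?thesis by (simp add: vector_matrix_mult_def)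
qed

lemma doubly_stochastic_mat_1: "doubly_stochastic (mat 1 :: real ^ 'n ^ 'n)"
proof -
  have "1 v* mat 1 = (1 :: real ^ 'n)" by (simp add: vector_matrix_mul_rid)
  then show ?thesis by (simp add: doubly_stochastic_def) (simp add: mat_def)
qed

lemma doubly_stochastic_mult:
  assumes "doubly_stochastic A" "doubly_stochastic A'"
  shows "doubly_stochastic (A ** A')"
proof -
  have "0 \<le> (A ** A') $ i $ j" for i j
    using assms unfolding doubly_stochastic_def matrix_matrix_mult_def
    by (auto intro!: sum_nonneg)
  moreover have "(A ** A') *v 1 = 1"
    using assms by (simp add: doubly_stochastic_def flip: matrix_vector_mul_assoc)
  moreover have "1 v* (A ** A') = 1"
    using assms by (simp add: doubly_stochastic_def flip: vector_matrix_mul_assoc)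
  ultimately show ?thesis unfolding doubly_stochastic_def by blast
qed

lemma doubly_stochastic_back_prod:
  assumes "\<And>k. doubly_stochastic (W k)"
  shows "doubly_stochastic (back_prod W b k)"
  by (induction b) (simp_all add: assms doubly_stochastic_mult doubly_stochastic_mat_1)

lemma doubly_stochastic_averaging: "doubly_stochastic (averaging_matrix :: real ^ 'n ^ 'n)"
  by (simp add: doubly_stochastic_def averaging_matrix_def vec_eq_iff matrix_vector_mult_def
      vector_matrix_mult_def)

lemma matrix_diff_mult_distribs:
  fixes A A' :: "real ^ 'n ^ 'm" and v v' :: "real ^ 'p ^ 'n"
  shows "A ** (v - v') = A ** v - A ** v'" and "(A - A') ** v = A ** v - A' ** v"
  by (simp_all add: matrix_matrix_mult_def vec_eq_iff sum_subtractf algebra_simps)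

lemma row_mean_stochastic_mult:
  fixes A :: "real ^ 'n ^ 'n" and v :: "real ^ 'p ^ 'n"
  assumes "doubly_stochastic A"
  shows "row_mean (A ** v) = row_mean v"
proof -
  have "(\<Sum>i\<in>UNIV. (A ** v) $ i) = (\<Sum>i\<in>UNIV. \<Sum>j\<in>UNIV. A $ i $ j *\<^sub>R v $ j)"
    by (simp add: row_matrix_mult)
  also have "\<dots> = (\<Sum>j\<in>UNIV. \<Sum>i\<in>UNIV. A $ i $ j *\<^sub>R v $ j)"
    by (rule sum.swap)
  also have "\<dots> = (\<Sum>j\<in>UNIV. v $ j)"
    by (simp add: scaleR_left.sum [symmetric] doubly_stochastic_col_sum [OF assms])
  finally show ?thesis by (simp add: row_mean_def)
qed

text \<open>Unit row sums fix constant stacks and unit column sums preserve the mean, so mixing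
  commutes with the projection.\<close>

lemma deviation_stochastic_mult:
  fixes A :: "real ^ 'n ^ 'n" and v :: "real ^ 'p ^ 'n"
  assumes "doubly_stochastic A"
  shows "deviation (A ** v) = A ** deviation v"
proof -
  have "A ** (\<chi> i. row_mean v) = (\<chi> i. row_mean v)"
    by (simp add: vec_eq_iff [of "A ** _"] row_matrix_mult scaleR_left.sum [symmetric]
        doubly_stochastic_row_sum [OF assms])
  then show ?thesis
    by (simp add: deviation_def matrix_diff_mult_distribs row_mean_stochastic_mult [OF assms])
qed

lemma averaging_matrix_mult:
  fixes v :: "real ^ 'p ^ 'n"
  shows "averaging_matrix ** v = (\<chi> i. row_mean v)"
  by (simp add: vec_eq_iff [of "_ ** _"] row_matrix_mult averaging_matrix_def row_mean_def
      scaleR_right.sum)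

text \<open>Jensen's inequality for the square, each row being a convex combination; summing over
  the rows then uses that the columns sum to one.\<close>

lemma norm_stochastic_mult_vec_le:
  fixes A :: "real ^ 'n ^ 'n"
  assumes A: "doubly_stochastic A"
  shows "norm (A *v u) \<le> norm u"
proof (rule power2_le_imp_le)
  have row: "((A *v u) $ i)\<^sup>2 \<le> (\<Sum>j\<in>UNIV. A $ i $ j * (u $ j)\<^sup>2)" for i
    using convex_on_sum [of UNIV UNIV "\<lambda>t::real. t\<^sup>2" "\<lambda>j. A $ i $ j" "\<lambda>j. u $ j"] convex_power2
      doubly_stochastic_nonneg [OF A] doubly_stochastic_row_sum [OF A]
    by (simp add: matrix_vector_mult_def)
  have "(norm (A *v u))\<^sup>2 = (\<Sum>i\<in>UNIV. ((A *v u) $ i)\<^sup>2)"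
    by (rule norm_squared_cart)
  also have "\<dots> \<le> (\<Sum>i\<in>UNIV. \<Sum>j\<in>UNIV. A $ i $ j * (u $ j)\<^sup>2)"
    by (intro sum_mono row)
  also have "\<dots> = (\<Sum>j\<in>UNIV. \<Sum>i\<in>UNIV. A $ i $ j * (u $ j)\<^sup>2)"
    by (rule sum.swap)
  also have "\<dots> = (\<Sum>j\<in>UNIV. (u $ j)\<^sup>2)"
    by (simp flip: sum_distrib_right add: doubly_stochastic_col_sum [OF A])
  also have "\<dots> = (norm u)\<^sup>2"
    by (rule norm_squared_cart [symmetric])
  finally show "(norm (A *v u))\<^sup>2 \<le> (norm u)\<^sup>2" .
qed simp

lemma norm_stochastic_mult_le:
  fixes v :: "real ^ 'p ^ 'n"
  assumes "doubly_stochastic A"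
  shows "norm (A ** v) \<le> norm v"
  using norm_matrix_mult_le [of A 1 v] norm_stochastic_mult_vec_le [OF assms] by simp

text \<open>A real \<open>SUP\<close> is known to bound its members only when the set is bounded
  above. Nonexpansiveness of both matrices gives the crude bound 2.\<close>

lemma sigma_max_back_prod_le_SUP:
  fixes W :: "nat \<Rightarrow> real ^ 'n ^ 'n"
  assumes W: "\<And>k. doubly_stochastic (W k)" and k: "B - 1 \<le> k"
  shows "sigma_max (back_prod W B k - averaging_matrix)
    \<le> (SUP k\<in>{B - 1..}. sigma_max (back_prod W B k - averaging_matrix))"
proof (rule cSUP_upper)
  have "sigma_max (back_prod W B k - averaging_matrix) \<le> 2" for k
  proof (rule sigma_max_le)
    fix u :: "real ^ 'n"
    have "norm ((back_prod W B k - averaging_matrix) *v u)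
      \<le> norm (back_prod W B k *v u) + norm (averaging_matrix *v u)"
      by (simp add: matrix_vector_mult_diff_rdistrib norm_triangle_ineq4)
    also have "\<dots> \<le> norm u + norm u"
      by (intro add_mono norm_stochastic_mult_vec_le doubly_stochastic_back_prod W
          doubly_stochastic_averaging)
    finally show "norm ((back_prod W B k - averaging_matrix) *v u) \<le> 2 * norm u" by simp
  qed simp
  then show "bdd_above ((\<lambda>k. sigma_max (back_prod W B k - averaging_matrix)) ` {B - 1..})"
    by (intro bdd_aboveI2)
qed (use k in auto)

text \<open>Variation of constants over the last \<open>b\<close> steps: the perturbation
  \<open>w (k - t)\<close> has been mixed \<open>t\<close> times since it entered. The bound on
  \<open>b\<close> keeps truncated subtraction from distorting the indices.\<close>

lemma deviation_iterate:
  fixes W :: "nat \<Rightarrow> real ^ 'n ^ 'n" and v w :: "nat \<Rightarrow> real ^ 'p ^ 'n"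
  assumes W: "\<And>k. doubly_stochastic (W k)"
    and step: "\<And>k. v (Suc k) = W k ** v k + w k"
    and "b \<le> Suc k"
  shows "deviation (v (Suc k)) = back_prod W b k ** deviation (v (Suc k - b))
    + (\<Sum>t<b. back_prod W t k ** deviation (w (k - t)))"
  using \<open>b \<le> Suc k\<close>
proof (induction b)
  case 0
  show ?case by (simp only: back_prod.simps matrix_mul_lid lessThan_0 sum.empty diff_zero add_0_right)
next
  case (Suc b)
  have idx: "Suc k - b = Suc (k - b)" "Suc k - Suc b = k - b" using Suc.prems by auto
  have dev: "deviation (v (Suc (k - b))) = W (k - b) ** deviation (v (k - b)) + deviation (w (k - b))"
    unfolding step by (simp only: deviation_add deviation_stochastic_mult [OF W])
  have "deviation (v (Suc k)) = back_prod W b k ** deviation (v (Suc (k - b)))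
      + (\<Sum>t<b. back_prod W t k ** deviation (w (k - t)))"
    using Suc.IH Suc.prems unfolding idx by linarith
  then show ?case
    unfolding dev idx matrix_add_ldistrib matrix_mul_assoc back_prod.simps sum.lessThan_Suc
    by (simp only: add_ac)
qed

text \<open>The averaging matrix annihilates deviations, so on them the \<open>B\<close>-fold
  product acts like its difference from that matrix and contracts by \<delta>. The shorter products
  in front of the perturbations are merely nonexpansive. It is applied below to both
  \<open>x\<close> and \<open>y\<close>.\<close>

lemma norm_deviation_step:
  fixes W :: "nat \<Rightarrow> real ^ 'n ^ 'n" and v w :: "nat \<Rightarrow> real ^ 'p ^ 'n"
  assumes W: "\<And>k. doubly_stochastic (W k)"
    and step: "\<And>k. v (Suc k) = W k ** v k + w k"
    and \<sigma>: "sigma_max (back_prod W B k - averaging_matrix) \<le> \<delta>" and "B \<le> Suc k"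
  shows "norm (deviation (v (Suc k)))
    \<le> \<delta> * norm (deviation (v (Suc k - B))) + (\<Sum>t<B. norm (deviation (w (k - t))))"
proof -
  let ?u = "deviation (v (Suc k - B))"
  have \<delta>: "0 \<le> \<delta>" using \<sigma> sigma_max_nonneg order_trans by blast
  have "averaging_matrix ** ?u = 0"
    by (simp add: averaging_matrix_mult row_mean_deviation vec_eq_iff)
  then have "back_prod W B k ** ?u = (back_prod W B k - averaging_matrix) ** ?u"
    by (simp add: matrix_diff_mult_distribs)
  moreover have "norm ((back_prod W B k - averaging_matrix) ** ?u) \<le> \<delta> * norm ?u"
    by (rule norm_matrix_mult_le [OF order_trans [OF norm_le_sigma_max] \<delta>])
      (simp add: mult_right_mono \<sigma>)
  ultimately have "norm (back_prod W B k ** ?u) \<le> \<delta> * norm ?u" by simp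
  moreover have "norm (\<Sum>t<B. back_prod W t k ** deviation (w (k - t)))
      \<le> (\<Sum>t<B. norm (deviation (w (k - t))))"
    by (intro sum_norm_le norm_stochastic_mult_le doubly_stochastic_back_prod W)
  ultimately show ?thesis
    unfolding deviation_iterate [of W v w B k, OF W step \<open>B \<le> Suc k\<close>]
    by (intro order_trans [OF norm_triangle_ineq] add_mono)
qed

subsection \<open>Gradients and inexact gradient descent\<close>

text \<open>The derivative is a functional represented by its adjoint at 1; uniqueness of
  derivatives leaves no other candidate, so the definite description in \<open>grad\<close> denotes
  it.\<close>

lemma GDERIV_grad:
  fixes f :: "'a::euclidean_space \<Rightarrow> real"
  assumes "f differentiable (at x)"
  shows "GDERIV f x :> grad f x"
proof -
  obtain f' where f': "(f has_derivative f') (at x)"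
    using assms by (auto simp: differentiable_def)
  then interpret bounded_linear f' by (rule has_derivative_bounded_linear)
  have "f' h = h \<bullet> adjoint f' 1" for h
    using adjoint_works [OF linear_axioms, of h 1] by simp
  then have "f' = (\<lambda>h. h \<bullet> adjoint f' 1)" by blast
  with f' have D: "GDERIV f x :> adjoint f' 1" by (simp add: gderiv_def)
  show ?thesis
    unfolding grad_def
  proof (rule theI [where P = "\<lambda>d. GDERIV f x :> d", OF D])
    fix d assume "GDERIV f x :> d"
    then have "(\<lambda>h. h \<bullet> d) = (\<lambda>h. h \<bullet> adjoint f' 1)"
      using D has_derivative_unique unfolding gderiv_def by blast
    then show "d = adjoint f' 1"
      by (metis inner_commute vector_eq_ldot)
  qed
qed

text \<open>The descent lemma: along the segment from \<open>x\<close> to \<open>z\<close> the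
  remainder \<phi> has nonpositive derivative, as the gradient changes by at most
  \<open>L * t * norm d\<close>.\<close>

lemma Lipschitz_gradient_upper_bound:
  fixes f :: "'a::real_inner \<Rightarrow> real"
  assumes deriv: "\<And>x. GDERIV f x :> g x"
    and Lip: "\<And>x y. norm (g x - g y) \<le> L * norm (x - y)"
  shows "f z \<le> f x + g x \<bullet> (z - x) + L / 2 * (norm (z - x))\<^sup>2"
proof -
  define d where "d = z - x"
  define \<phi> where "\<phi> t = f (x + t *\<^sub>R d) - t * (g x \<bullet> d) - L / 2 * t\<^sup>2 * (norm d)\<^sup>2" for t
  have "\<phi> 1 \<le> \<phi> 0"
  proof (rule DERIV_nonpos_imp_nonincreasing [of 0 1 \<phi>])
    fix t :: real assume t: "0 \<le> t" "t \<le> 1"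
    have "((\<lambda>t. f (x + t *\<^sub>R d)) has_derivative (\<lambda>h. (h *\<^sub>R d) \<bullet> g (x + t *\<^sub>R d))) (at t)"
      by (rule has_derivative_compose [where f = "\<lambda>t. x + t *\<^sub>R d" and g = f])
        (use deriv in \<open>auto intro!: derivative_eq_intros simp: gderiv_def\<close>)
    then have "((\<lambda>t. f (x + t *\<^sub>R d)) has_real_derivative g (x + t *\<^sub>R d) \<bullet> d) (at t)"
      by (simp add: has_field_derivative_def inner_commute mult_commute_abs)
    then have "(\<phi> has_real_derivative g (x + t *\<^sub>R d) \<bullet> d - g x \<bullet> d - L * t * (norm d)\<^sup>2) (at t)"
      unfolding \<phi>_def by (auto intro!: derivative_eq_intros)
    moreover have "(g (x + t *\<^sub>R d) - g x) \<bullet> d \<le> L * t * (norm d)\<^sup>2"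
    proof -
      have "(g (x + t *\<^sub>R d) - g x) \<bullet> d \<le> norm (g (x + t *\<^sub>R d) - g x) * norm d"
        by (rule norm_cauchy_schwarz)
      also have "\<dots> \<le> L * norm (t *\<^sub>R d) * norm d"
        using Lip [of "x + t *\<^sub>R d" x] by (intro mult_right_mono) auto
      finally show ?thesis using t by (simp add: power2_eq_square)
    qed
    ultimately show "\<exists>y. (\<phi> has_real_derivative y) (at t) \<and> y \<le> 0"
      by (auto simp: inner_diff_left)
  qed simp
  then show ?thesis by (simp add: \<phi>_def d_def)
qed

text \<open>A gradient step with step-size \<open>1 / L\<close> lowers \<open>F\<close> by at least
  \<open>(norm (G x))\<^sup>2 / (2 * L)\<close>, yet cannot pass below the minimum.\<close>

lemma norm_gradient_le_gap:
  fixes F :: "'a::real_inner \<Rightarrow> real"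
  assumes upper: "\<And>x y. F y \<le> F x + G x \<bullet> (y - x) + L / 2 * (norm (y - x))\<^sup>2"
    and min: "\<And>x. F z \<le> F x" and "0 < L"
  shows "(norm (G x))\<^sup>2 \<le> 2 * L * (F x - F z)"
proof -
  have "F z \<le> F (x - (1 / L) *\<^sub>R G x)" by (rule min)
  also have "\<dots> \<le> F x - (1 / L) * (norm (G x))\<^sup>2 + L / 2 * ((1 / L)\<^sup>2 * (norm (G x))\<^sup>2)"
    using upper [of "x - (1 / L) *\<^sub>R G x" x]
    by (simp add: power2_norm_eq_inner [symmetric] power_divide)
  also have "\<dots> = F x - (norm (G x))\<^sup>2 / (2 * L)"
    using \<open>0 < L\<close> by (simp add: field_simps power2_eq_square)
  finally show ?thesis using \<open>0 < L\<close> by (simp add: field_simps)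
qed

text \<open>Quadratic growth makes a minimiser over a compact ball global, so Fermat's rule applies
  without a boundary case.\<close>

lemma strongly_convex_ex_stationary:
  fixes F :: "'a::euclidean_space \<Rightarrow> real"
  assumes deriv: "\<And>x. GDERIV F x :> G x"
    and lower: "\<And>x y. F x \<ge> F y + G y \<bullet> (x - y) + m / 2 * (norm (x - y))\<^sup>2"
    and "0 < m"
  shows "\<exists>z. G z = 0"
proof -
  \<comment> \<open>Outside this radius the quadratic term of \<open>lower\<close> at 0 outweighs
    the linear one, so \<open>F x\<close> is at least \<open>F 0\<close>.\<close>
  define r where "r = 2 * norm (G 0) / m"
  have cont: "continuous_on S F" for S
    using deriv unfolding gderiv_def
    by (meson continuous_at_imp_continuous_on has_derivative_continuous)
  have "0 \<le> r" using \<open>0 < m\<close> by (simp add: r_def)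
  then obtain z where z: "z \<in> cball 0 r" "\<And>x. x \<in> cball 0 r \<Longrightarrow> F z \<le> F x"
    using continuous_attains_inf [OF compact_cball _ cont, of 0 r] by auto
  have "F z \<le> F x" for x
  proof (cases "x \<in> cball 0 r")
    case False
    then have "2 * norm (G 0) \<le> m * norm x"
      using \<open>0 < m\<close> by (simp add: r_def field_simps)
    then have "norm (G 0) * norm x \<le> m / 2 * (norm x)\<^sup>2"
      using mult_right_mono [of "2 * norm (G 0)" "m * norm x" "norm x"]
      by (simp add: power2_eq_square)
    moreover have "- (G 0 \<bullet> x) \<le> norm (G 0) * norm x"
      by (metis Cauchy_Schwarz_ineq2 abs_le_D2)
    ultimately have "F 0 \<le> F x" using lower [of 0 x] by simp
    moreover have "F z \<le> F 0" using z(2) \<open>0 \<le> r\<close> by simp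
    ultimately show ?thesis by simp
  qed (use z in auto)
  then have "(\<lambda>h. h \<bullet> G z) = (\<lambda>h. 0)"
    using deriv [of z] unfolding gderiv_def
    by (intro has_derivative_local_min) auto
  then have "G z \<bullet> G z = 0" by metis
  then show ?thesis by auto
qed

text \<open>Each gradient is taken at its own row \<open>v $ i\<close> and not at the mean, so this
  is gradient descent with an error quadratic in the deviation. The summands are merely convex; the
  contraction comes from the growth of the average around \<open>z\<close>.\<close>

lemma inexact_gradient_step:
  fixes f :: "'n::finite \<Rightarrow> 'a::real_inner \<Rightarrow> real" and g :: "'n \<Rightarrow> 'a \<Rightarrow> 'a" and v :: "'a ^ 'n"
  defines "G \<equiv> \<lambda>x. (1 / real CARD('n)) *\<^sub>R (\<Sum>i\<in>UNIV. g i x)"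
    and "gbar \<equiv> (1 / real CARD('n)) *\<^sub>R (\<Sum>i\<in>UNIV. g i (v $ i))"
  assumes upper: "\<And>i x y. f i y \<le> f i x + g i x \<bullet> (y - x) + L / 2 * (norm (y - x))\<^sup>2"
    and convex: "\<And>i x y. f i y \<ge> f i x + g i x \<bullet> (y - x)"
    and Lip: "\<And>i x y. norm (g i x - g i y) \<le> L * norm (x - y)"
    and strong: "\<And>x. avg_fun f x \<ge> avg_fun f z + m / 2 * (norm (x - z))\<^sup>2"
    and "0 \<le> m" "0 < L" "0 < \<alpha>" "\<alpha> * L \<le> 1 / 10"
  shows "(norm (row_mean v - \<alpha> *\<^sub>R gbar - z))\<^sup>2
    \<le> (1 - 4 / 5 * \<alpha> * m) * (norm (row_mean v - z))\<^sup>2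
      + 6 / 5 * \<alpha> * L / real CARD('n) * (norm (deviation v))\<^sup>2"
proof -
  define N where "N = real CARD('n)"
  define b where "b = row_mean v"
  define e where "e = (norm (deviation v))\<^sup>2 / N"
  define D where "D = avg_fun f b - avg_fun f z"
  have N: "0 < N" by (simp add: N_def)
  have e: "(\<Sum>i\<in>UNIV. (norm (v $ i - b))\<^sup>2) = N * e"
    using N by (simp add: e_def deviation_def b_def power2_norm_eq_inner inner_vec_def)
  have D0: "m / 2 * (norm (b - z))\<^sup>2 \<le> D" using strong [of b] by (simp add: D_def)
  then have "0 \<le> D" using \<open>0 \<le> m\<close> by (meson divide_nonneg_nonneg order_trans zero_le_mult_iff zero_le_numeral zero_le_power2)
  have avg: "avg_fun f x = (1 / N) * (\<Sum>i\<in>UNIV. f i x)" for x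
    by (simp add: avg_fun_def N_def)
  \<comment> \<open>The descent bound from \<open>v $ i\<close> to \<open>b\<close> and convexity
    from \<open>v $ i\<close> to \<open>z\<close> share the gradient at \<open>v $ i\<close>;
    subtracting them leaves \<open>b - z\<close>.\<close>
  have key1: "D - L / 2 * e \<le> gbar \<bullet> (b - z)"
  proof -
    have "f i b - f i z - L / 2 * (norm (v $ i - b))\<^sup>2 \<le> g i (v $ i) \<bullet> (b - z)" for i
      using upper [of i b "v $ i"] convex [of i "v $ i" z]
      by (simp add: inner_diff_right norm_minus_commute)
    then have "(\<Sum>i\<in>UNIV. f i b - f i z - L / 2 * (norm (v $ i - b))\<^sup>2)
        \<le> (\<Sum>i\<in>UNIV. g i (v $ i) \<bullet> (b - z))"
      by (rule sum_mono)
    then have "N * D - L / 2 * (N * e) \<le> N * (gbar \<bullet> (b - z))"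
      using N by (simp add: D_def avg gbar_def inner_sum_left sum_subtractf N_def [symmetric]
          right_diff_distrib e [symmetric] sum_distrib_left)
    then have "N * (D - L / 2 * e) \<le> N * (gbar \<bullet> (b - z))"
      by (simp add: algebra_simps)
    then show ?thesis using N by simp
  qed
  have key2: "(norm (gbar - G b))\<^sup>2 \<le> L\<^sup>2 * e"
  proof -
    define u where "u = (\<chi> i. g i (v $ i) - g i b)"
    have "N * (norm (row_mean u))\<^sup>2 \<le> (norm u)\<^sup>2"
      using norm_squared_deviation [of u] zero_le_power2 [of "norm (deviation u)"]
      unfolding N_def by linarith
    also have "\<dots> = (\<Sum>i\<in>UNIV. (norm (g i (v $ i) - g i b))\<^sup>2)"
      by (simp add: u_def power2_norm_eq_inner inner_vec_def)
    also have "\<dots> \<le> (\<Sum>i\<in>UNIV. (L * norm (v $ i - b))\<^sup>2)"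
      by (intro sum_mono power_mono Lip) auto
    also have "\<dots> = N * (L\<^sup>2 * e)"
      by (simp add: power_mult_distrib sum_distrib_left [symmetric] e)
    finally have "(norm (row_mean u))\<^sup>2 \<le> L\<^sup>2 * e" using N by simp
    moreover have "row_mean u = gbar - G b"
      by (simp add: row_mean_def u_def gbar_def G_def sum_subtractf scaleR_diff_right)
    ultimately show ?thesis by simp
  qed
  have key3: "(norm (G b))\<^sup>2 \<le> 2 * L * D"
    unfolding D_def
  proof (rule norm_gradient_le_gap [OF _ _ \<open>0 < L\<close>])
    fix x y
    have "(\<Sum>i\<in>UNIV. f i y) \<le> (\<Sum>i\<in>UNIV. f i x + g i x \<bullet> (y - x) + L / 2 * (norm (y - x))\<^sup>2)"
      by (intro sum_mono upper)
    also have "\<dots> = (\<Sum>i\<in>UNIV. f i x) + (\<Sum>i\<in>UNIV. g i x) \<bullet> (y - x) + N * (L / 2 * (norm (y - x))\<^sup>2)"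
      by (simp add: sum.distrib inner_sum_left N_def)
    finally have "(1 / N) * (\<Sum>i\<in>UNIV. f i y) \<le> (1 / N) * \<dots>"
      using N by (intro mult_left_mono) auto
    then show "avg_fun f y \<le> avg_fun f x + G x \<bullet> (y - x) + L / 2 * (norm (y - x))\<^sup>2"
      using N by (simp add: avg G_def N_def [symmetric] distrib_left)
  next
    fix x
    have "0 \<le> m / 2 * (norm (x - z))\<^sup>2" using \<open>0 \<le> m\<close> by simp
    then show "avg_fun f z \<le> avg_fun f x" using strong [of x] by linarith
  qed
  \<comment> \<open>The difference of the two sides is the square of
    \<open>norm (gbar - 2 *\<^sub>R G b)\<close>.\<close>
  have "(norm gbar)\<^sup>2 \<le> 2 * (norm (G b))\<^sup>2 + 2 * (norm (gbar - G b))\<^sup>2"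
    using zero_le_power2 [of "norm (gbar - 2 *\<^sub>R G b)"] unfolding power2_norm_eq_inner
    by (simp add: inner_diff_left inner_diff_right inner_commute)
  then have gb: "(norm gbar)\<^sup>2 \<le> 4 * L * D + 2 * L\<^sup>2 * e"
    using key2 key3 by linarith
  have "(norm (b - \<alpha> *\<^sub>R gbar - z))\<^sup>2
      = (norm (b - z))\<^sup>2 - 2 * \<alpha> * (gbar \<bullet> (b - z)) + \<alpha>\<^sup>2 * (norm gbar)\<^sup>2"
    unfolding power2_norm_eq_inner
    by (simp add: inner_diff_left inner_diff_right inner_commute power2_eq_square algebra_simps)
  also have "\<dots> \<le> (norm (b - z))\<^sup>2 - 2 * \<alpha> * (D - L / 2 * e) + \<alpha>\<^sup>2 * (4 * L * D + 2 * L\<^sup>2 * e)"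
    using key1 gb \<open>0 < \<alpha>\<close> by (intro add_mono diff_mono mult_left_mono) auto
  also have "\<dots> = (norm (b - z))\<^sup>2 - (2 - 4 * (\<alpha> * L)) * (\<alpha> * D) + (1 + 2 * (\<alpha> * L)) * (\<alpha> * L * e)"
    by (simp add: algebra_simps power2_eq_square)
  \<comment> \<open>From \<open>\<alpha> * L \<le> 1 / 10\<close> the two coefficients satisfy
    \<open>2 - 4 * (\<alpha> * L) \<ge> 8 / 5\<close> and
    \<open>1 + 2 * (\<alpha> * L) \<le> 6 / 5\<close>.\<close>
  also have "\<dots> \<le> (norm (b - z))\<^sup>2 - 8 / 5 * (\<alpha> * D) + 6 / 5 * (\<alpha> * L * e)"
    using \<open>\<alpha> * L \<le> 1 / 10\<close> \<open>0 < \<alpha>\<close> \<open>0 < L\<close> \<open>0 \<le> D\<close> N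
    by (intro add_mono diff_mono mult_right_mono) (auto simp: e_def mult.commute)
  also have "\<dots> \<le> (norm (b - z))\<^sup>2 - 8 / 5 * (\<alpha> * (m / 2 * (norm (b - z))\<^sup>2)) + 6 / 5 * (\<alpha> * L * e)"
    using D0 \<open>0 < \<alpha>\<close> by (intro add_right_mono diff_mono mult_left_mono) auto
  finally show ?thesis
    by (simp add: b_def e_def N_def algebra_simps)
qed

subsection \<open>Cyclic recurrences and the rate\<close>

text \<open>
  The bounds \<open>X k \<le> s * l ^ k\<close>, \<open>R k \<le> \<rho> * s * l ^ k\<close>, \<open>Y k \<le> \<eta> * s * l ^ k\<close> reproduce themselves
  around the loop of the three inequalities, because the loop gain is at most 1; \<open>s\<close> only has to
  dominate the first \<open>B\<close> terms.
\<close>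

lemma cyclic_recurrence_geometric_bound:
  fixes X Y R :: "nat \<Rightarrow> real" and l \<delta> \<alpha> L a c \<sigma> \<rho> :: real
  assumes l: "0 < l" "l \<le> 1" and "0 < B" and \<delta>: "0 \<le> \<delta>" "\<delta> < l ^ B"
    and "0 \<le> \<alpha>" "0 < L" "0 \<le> \<sigma>" "0 < \<rho>" "0 \<le> a" "0 \<le> c"
    and nonneg: "\<And>k. 0 \<le> X k" "\<And>k. 0 \<le> Y k" "\<And>k. 0 \<le> R k"
    and X: "\<And>k. B \<le> Suc k \<Longrightarrow> X (Suc k) \<le> \<delta> * X (Suc k - B) + \<alpha> * (\<Sum>t<B. Y (k - t))"
    and Y: "\<And>k. B \<le> Suc k \<Longrightarrow> Y (Suc k) \<le> \<delta> * Y (Suc k - B)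
        + (\<Sum>t<B. L * ((X (Suc (k - t)) + \<sigma> * R (Suc (k - t))) + (X (k - t) + \<sigma> * R (k - t))))"
    and R: "\<And>k. (R (Suc k))\<^sup>2 \<le> a * (R k)\<^sup>2 + c * (X k)\<^sup>2"
    and gain_R: "a + c / \<rho>\<^sup>2 \<le> l\<^sup>2"
    and gain: "2 * \<alpha> * L * (real B)\<^sup>2 * (1 + \<sigma> * \<rho>) \<le> (l ^ B - \<delta>)\<^sup>2"
  shows "\<exists>C. \<forall>k. X k + \<sigma> * R k \<le> C * l ^ k"
proof -
  define D where "D = l ^ B - \<delta>"
  define q where "q = 1 + \<sigma> * \<rho>"
  \<comment> \<open>\<eta> makes the \<open>Y\<close> inequality close with equality, as
    \<open>\<delta> * \<eta> + 2 * L * real B * q = l ^ B * \<eta>\<close>; the gain condition then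
    says exactly that the \<open>X\<close> inequality closes.\<close>
  define \<eta> where "\<eta> = 2 * L * real B * q / D"
  have D: "0 < D" using \<delta> by (simp add: D_def)
  have q: "1 \<le> q" using \<open>0 \<le> \<sigma>\<close> \<open>0 < \<rho>\<close> by (simp add: q_def)
  have \<eta>: "0 < \<eta>" using D q \<open>0 < L\<close> \<open>0 < B\<close> by (simp add: \<eta>_def)
  have \<alpha>\<eta>: "\<alpha> * (real B * \<eta>) \<le> D"
    using gain D by (simp add: \<eta>_def field_simps power2_eq_square q_def D_def)
  \<comment> \<open>The summands are nonnegative and weighted by their targets, so one constant
    dominates the first \<open>B\<close> values of all three sequences.\<close>
  define s where "s = (\<Sum>j<B. X j / l ^ j + R j / (\<rho> * l ^ j) + Y j / (\<eta> * l ^ j))"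
  have terms: "0 \<le> X j / l ^ j" "0 \<le> R j / (\<rho> * l ^ j)" "0 \<le> Y j / (\<eta> * l ^ j)" for j
    using nonneg l \<open>0 < \<rho>\<close> \<eta> by simp_all
  have s: "0 \<le> s" unfolding s_def by (intro sum_nonneg add_nonneg_nonneg terms)
  have init: "X j \<le> s * l ^ j \<and> R j \<le> \<rho> * s * l ^ j \<and> Y j \<le> \<eta> * s * l ^ j" if "j < B" for j
  proof -
    have "X j / l ^ j + R j / (\<rho> * l ^ j) + Y j / (\<eta> * l ^ j) \<le> s"
      unfolding s_def using that
      by (intro member_le_sum [where f = "\<lambda>j. X j / l ^ j + R j / (\<rho> * l ^ j) + Y j / (\<eta> * l ^ j)"]
          add_nonneg_nonneg terms) auto
    then have "X j / l ^ j \<le> s" "R j / (\<rho> * l ^ j) \<le> s" "Y j / (\<eta> * l ^ j) \<le> s"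
      using terms [of j] by linarith+
    then show ?thesis using l \<open>0 < \<rho>\<close> \<eta> by (simp add: divide_le_eq mult_ac)
  qed
  have Q_bound: "X j + \<sigma> * R j \<le> q * s * l ^ j"
    if "X j \<le> s * l ^ j" "R j \<le> \<rho> * s * l ^ j" for j
    using that(1) mult_left_mono [OF that(2) \<open>0 \<le> \<sigma>\<close>] by (simp add: q_def algebra_simps)
  have main: "X k \<le> s * l ^ k \<and> R k \<le> \<rho> * s * l ^ k \<and> Y k \<le> \<eta> * s * l ^ k" for k
  proof (induction k rule: less_induct)
    case (less k')
    show ?case
    proof (cases "k' < B")
      case False
      then obtain k where k: "k' = Suc k" "B \<le> Suc k" using \<open>0 < B\<close> by (cases k') auto
      have IH: "X j \<le> s * l ^ j" "R j \<le> \<rho> * s * l ^ j" "Y j \<le> \<eta> * s * l ^ j" if "j \<le> k" for j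
        using less.IH [of j] that k by auto
      \<comment> \<open>As \<open>l \<le> 1\<close>, every power of \<open>l\<close> in the window
        is at most the oldest one, \<open>p\<close>.\<close>
      define p where "p = l ^ (Suc k - B)"
      have p: "0 < p" using l by (simp add: p_def)
      have lp: "p * l ^ B = l ^ Suc k" using k by (simp add: p_def flip: power_add)
      have pow: "l ^ (k - t) \<le> p" if "t < B" for t
        unfolding p_def using that k l by (intro power_decreasing) auto
      have "(\<Sum>t<B. Y (k - t)) \<le> (\<Sum>t<B. \<eta> * s * p)"
      proof (rule sum_mono)
        fix t assume "t \<in> {..<B}"
        then show "Y (k - t) \<le> \<eta> * s * p"
          using pow \<eta> s by (intro order_trans [OF IH(3)] mult_left_mono) auto
      qed
      then have "X (Suc k) \<le> \<delta> * (s * p) + \<alpha> * (\<Sum>t<B. \<eta> * s * p)"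
        unfolding p_def using \<delta> \<open>0 \<le> \<alpha>\<close> IH(1) \<open>0 < B\<close>
        by (intro order_trans [OF X [OF k(2)]] add_mono mult_left_mono) auto
      also have "\<dots> = (\<delta> + \<alpha> * (real B * \<eta>)) * (s * p)" by (simp add: algebra_simps)
      also have "\<dots> \<le> (\<delta> + D) * (s * p)" using \<alpha>\<eta> s p by (intro mult_right_mono) auto
      also have "\<dots> = s * l ^ Suc k" using lp by (simp add: D_def mult_ac)
      finally have X': "X (Suc k) \<le> s * l ^ Suc k" .
      have "(R (Suc k))\<^sup>2 \<le> a * (\<rho> * s * l ^ k)\<^sup>2 + c * (s * l ^ k)\<^sup>2"
        using IH nonneg \<open>0 \<le> a\<close> \<open>0 \<le> c\<close>
        by (intro order_trans [OF R] add_mono mult_left_mono power_mono) auto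
      also have "\<dots> = (a + c / \<rho>\<^sup>2) * (\<rho> * s * l ^ k)\<^sup>2"
        using \<open>0 < \<rho>\<close> by (simp add: field_simps)
      also have "\<dots> \<le> l\<^sup>2 * (\<rho> * s * l ^ k)\<^sup>2" by (intro mult_right_mono gain_R) simp
      also have "\<dots> = (\<rho> * s * l ^ Suc k)\<^sup>2" by (simp add: power_mult_distrib mult_ac)
      finally have R': "R (Suc k) \<le> \<rho> * s * l ^ Suc k"
        by (rule power2_le_imp_le) (use s l \<open>0 < \<rho>\<close> in simp)
      \<comment> \<open>The \<open>Y\<close> inequality involves \<open>X\<close> and
        \<open>R\<close> at \<open>Suc k\<close> as well, hence the new bounds \<open>X'\<close> and
        \<open>R'\<close> come first.\<close>
      have Q: "X j + \<sigma> * R j \<le> q * s * l ^ j" if "j \<le> Suc k" for j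
        using that IH X' R' by (intro Q_bound) (auto simp: le_Suc_eq)
      have "L * ((X (Suc (k - t)) + \<sigma> * R (Suc (k - t))) + (X (k - t) + \<sigma> * R (k - t)))
          \<le> L * (q * s * p + q * s * p)" if "t < B" for t
      proof -
        have "l ^ Suc (k - t) \<le> l ^ (k - t)" using l by (intro power_decreasing) auto
        also have "\<dots> \<le> p" using pow that .
        finally show ?thesis
          using pow [OF that] q s \<open>0 < L\<close>
          by (intro mult_left_mono add_mono order_trans [OF Q] mult_left_mono) auto
      qed
      then have "(\<Sum>t<B. L * ((X (Suc (k - t)) + \<sigma> * R (Suc (k - t))) + (X (k - t) + \<sigma> * R (k - t))))
          \<le> (\<Sum>t<B. L * (q * s * p + q * s * p))"
        by (intro sum_mono) simp
      then have "Y (Suc k) \<le> \<delta> * (\<eta> * s * p) + (\<Sum>t<B. L * (q * s * p + q * s * p))"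
        unfolding p_def using \<delta> IH(3) \<open>0 < B\<close>
        by (intro order_trans [OF Y [OF k(2)]] add_mono mult_left_mono) auto
      also have "\<dots> = (\<delta> * \<eta> + 2 * L * real B * q) * (s * p)" by (simp add: algebra_simps)
      also have "2 * L * real B * q = D * \<eta>" using D by (simp add: \<eta>_def)
      also have "(\<delta> * \<eta> + D * \<eta>) * (s * p) = \<eta> * s * l ^ Suc k"
        using lp by (simp add: D_def algebra_simps)
      finally show ?thesis using X' R' k by simp
    qed (use init in auto)
  qed
  then have "X k + \<sigma> * R k \<le> (q * s) * l ^ k" for k using Q_bound by blast
  then show ?thesis by blast
qed

text \<open>In either branch \<open>l ^ B\<close> is the larger of
  \<open>sqrt (1 - \<alpha> * m / 1.5)\<close> and
  \<open>\<delta> + sqrt (\<alpha> * m * J / 1.5)\<close>: the first serves the means, the second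
  the deviations. \<open>small\<close> keeps the first radicand positive.\<close>

lemma diging_rate_bounds:
  fixes \<alpha> m \<delta> J :: real and B :: nat
  defines "l \<equiv> diging_rate B m \<delta> J \<alpha>"
  assumes "0 < B" "0 \<le> \<delta>" "\<delta> < 1" "0 < m" "0 < J" "0 < \<alpha>"
    and \<alpha>: "\<alpha> \<le> 1.5 * (1 - \<delta>)\<^sup>2 / (m * J)" and small: "\<alpha> * m < 1.5"
  shows "0 < l" "l \<le> 1" "\<delta> < l ^ B" "\<alpha> * m * J / 1.5 \<le> (l ^ B - \<delta>)\<^sup>2" "1 - \<alpha> * m / 1.5 \<le> l\<^sup>2"
proof -
  \<comment> \<open>In the variable \<open>t\<close> the branch condition becomes
    \<open>t \<le> t0\<close>, free of the squares in \<open>diging_threshold\<close>.\<close>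
  define u where "u = \<alpha> * m / 1.5"
  define t where "t = sqrt (u * J)"
  define r where "r = sqrt (J\<^sup>2 + (1 - \<delta>\<^sup>2) * J)"
  define t0 where "t0 = (r - \<delta> * J) / (J + 1)"
  have u: "0 < u" "u < 1" using assms by (simp_all add: u_def)
  have t: "0 < t" "t\<^sup>2 = u * J" using u \<open>0 < J\<close> by (simp_all add: t_def)
  have \<delta>2: "\<delta>\<^sup>2 < 1" using \<open>0 \<le> \<delta>\<close> \<open>\<delta> < 1\<close> by (simp add: power_less_one_iff abs_square_less_1)
  have r2: "r\<^sup>2 = J\<^sup>2 + (1 - \<delta>\<^sup>2) * J" and r: "0 \<le> r"
    using \<delta>2 \<open>0 < J\<close> by (simp_all add: r_def)
  have "(\<delta> * J)\<^sup>2 \<le> r\<^sup>2"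
    unfolding r2 power_mult_distrib using \<delta>2 \<open>0 < J\<close> mult_right_mono [of "\<delta>\<^sup>2" 1 "J\<^sup>2"]
    by (simp add: add_increasing2)
  then have "\<delta> * J \<le> r" using r by (rule power2_le_imp_le)
  then have t0: "0 \<le> t0" using \<open>0 < J\<close> by (simp add: t0_def)
  have threshold: "\<alpha> \<le> diging_threshold m \<delta> J \<longleftrightarrow> t \<le> t0"
  proof -
    have "\<alpha> \<le> diging_threshold m \<delta> J \<longleftrightarrow> u * J \<le> t0\<^sup>2"
      unfolding diging_threshold_def r_def [symmetric] u_def t0_def power_divide
      using \<open>0 < m\<close> \<open>0 < J\<close> by (simp add: field_simps)
    also have "\<dots> \<longleftrightarrow> t \<le> t0"
      using t t0 abs_le_square_iff [of t t0] by simp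
    finally show ?thesis .
  qed
  \<comment> \<open>\<open>t0\<close> is the nonnegative root in \<open>t\<close> of \<open>(\<delta> + t)\<^sup>2 = 1 - t\<^sup>2 / J\<close>, where the two rates agree.\<close>
  have "(J + 1) * t0 = r - \<delta> * J" using \<open>0 < J\<close> by (simp add: t0_def)
  then have t0_factor: "(J + 1) * (t0 - t) = r - \<delta> * J - (J + 1) * t"
    by (simp add: right_diff_distrib)
  \<comment> \<open>The second factor is positive, the other root of the quadratic being negative.
    So the sign of \<open>t0 - t\<close> decides which of \<open>1 - u\<close> and
    \<open>(\<delta> + t)\<^sup>2\<close> is larger.\<close>
  have quad: "J * (1 - u - (\<delta> + t)\<^sup>2) = (t0 - t) * ((J + 1) * t + (r + \<delta> * J))"
  proof -
    have "(J + 1) * ((t0 - t) * ((J + 1) * t + (r + \<delta> * J)))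
        = (r - \<delta> * J - (J + 1) * t) * ((J + 1) * t + (r + \<delta> * J))"
      by (simp only: t0_factor flip: mult.assoc)
    also have "\<dots> = r\<^sup>2 - (\<delta> * J)\<^sup>2 - 2 * \<delta> * J * (J + 1) * t - (J + 1)\<^sup>2 * t\<^sup>2"
      by (simp add: algebra_simps power2_eq_square)
    also have "\<dots> = (J + 1) * (J * (1 - u - (\<delta> + t)\<^sup>2))"
      unfolding r2 power2_sum t(2) by (simp add: algebra_simps power2_eq_square)
    finally show ?thesis using \<open>0 < J\<close> by simp
  qed
  have factor: "0 < (J + 1) * t + (r + \<delta> * J)"
    using \<open>0 < J\<close> t r \<open>0 \<le> \<delta>\<close> by (simp add: add_pos_nonneg)
  have "u * J \<le> (1 - \<delta>)\<^sup>2"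
    using \<alpha> \<open>0 < m\<close> \<open>0 < J\<close> by (simp add: u_def field_simps)
  then have t1: "\<delta> + t \<le> 1"
    using power2_le_imp_le [of t "1 - \<delta>"] t \<open>\<delta> < 1\<close> by simp
  have all: "0 < l \<and> l \<le> 1 \<and> \<delta> + t \<le> l ^ B \<and> 1 - u \<le> l\<^sup>2"
  proof (cases "t \<le> t0")
    case True
    then have l: "l = root (2 * B) (1 - u)"
      using threshold by (simp add: l_def diging_rate_def u_def)
    have "0 < l" "l \<le> 1" using u \<open>0 < B\<close> by (simp_all add: l)
    moreover have l2B: "(l ^ B)\<^sup>2 = 1 - u"
      using u \<open>0 < B\<close> real_root_pow_pos2 [of "2 * B" "1 - u"] by (simp add: l power_mult [symmetric] mult.commute)
    moreover have "\<delta> + t \<le> l ^ B"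
    proof (rule power2_le_imp_le)
      have "0 \<le> J * (1 - u - (\<delta> + t)\<^sup>2)" unfolding quad using True factor by simp
      then show "(\<delta> + t)\<^sup>2 \<le> (l ^ B)\<^sup>2" using \<open>0 < J\<close> l2B by (simp add: zero_le_mult_iff)
    qed (use \<open>0 < l\<close> in simp)
    \<comment> \<open>The recurrence for the mean advances one step at a time and needs
      \<open>1 - u \<le> l\<^sup>2\<close>; this holds already for \<open>(l ^ B)\<^sup>2\<close>,
      which is no larger as \<open>l \<le> 1\<close>.\<close>
    moreover have "(l ^ B)\<^sup>2 \<le> l\<^sup>2"
      using \<open>0 < l\<close> \<open>l \<le> 1\<close> \<open>0 < B\<close> power_decreasing [of 1 B l] by (intro power_mono) auto
    ultimately show ?thesis by simp
  next
    case False
    then have l: "l = root B (t + \<delta>)"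
      using threshold by (simp add: l_def diging_rate_def u_def t_def mult_ac)
    have "0 < l" "l \<le> 1" using t t1 \<open>0 \<le> \<delta>\<close> \<open>0 < B\<close> by (simp_all add: l add_pos_nonneg)
    moreover have lB: "l ^ B = t + \<delta>"
      using t \<open>0 \<le> \<delta>\<close> \<open>0 < B\<close> by (simp add: l)
    moreover have "J * (1 - u - (\<delta> + t)\<^sup>2) \<le> 0"
      unfolding quad using False factor by (simp add: mult_le_0_iff)
    then have "1 - u \<le> (l ^ B)\<^sup>2" using \<open>0 < J\<close> by (simp add: mult_le_0_iff lB add.commute)
    moreover have "(l ^ B)\<^sup>2 \<le> l\<^sup>2"
      using \<open>0 < l\<close> \<open>l \<le> 1\<close> \<open>0 < B\<close> power_decreasing [of 1 B l] by (intro power_mono) auto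
    ultimately show ?thesis by simp
  qed
  then show "0 < l" "l \<le> 1" "1 - \<alpha> * m / 1.5 \<le> l\<^sup>2" by (simp_all add: u_def)
  show "\<delta> < l ^ B" using all t by linarith
  have "t\<^sup>2 \<le> (l ^ B - \<delta>)\<^sup>2" using all t by (intro power_mono) auto
  then show "\<alpha> * m * J / 1.5 \<le> (l ^ B - \<delta>)\<^sup>2" by (simp add: t(2) u_def)
qed

subsection \<open>Convergence of DIGing\<close>

lemma norm_diff_const_rows_le:
  fixes v :: "'a::real_inner ^ 'n"
  shows "norm (v - (\<chi> i. z)) \<le> norm (deviation v) + sqrt (real CARD('n)) * norm (row_mean v - z)"
proof -
  have "v - (\<chi> i. z) = deviation v + (\<chi> i. row_mean v - z)"
    by (simp add: deviation_def vec_eq_iff)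
  then show ?thesis by (metis norm_triangle_ineq norm_const_rows)
qed

lemma norm_stacked_grad_diff_le:
  fixes f :: "'n::finite \<Rightarrow> real ^ 'p \<Rightarrow> real" and u v :: "real ^ 'p ^ 'n"
  assumes "\<And>i x y. norm (grad (f i) x - grad (f i) y) \<le> L * norm (x - y)" and "0 \<le> L"
  shows "norm (stacked_grad f u - stacked_grad f v) \<le> L * norm (u - v)"
proof -
  have "norm (stacked_grad f u - stacked_grad f v) \<le> L2_set (\<lambda>i. L * norm ((u - v) $ i)) UNIV"
    unfolding norm_vec_def [of "stacked_grad f u - _"]
    using assms by (intro L2_set_mono) (auto simp: stacked_grad_def)
  also have "\<dots> = L * norm (u - v)"
    unfolding norm_vec_def [of "u - v"] using \<open>0 \<le> L\<close> by (simp add: L2_set_right_distrib)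
  finally show ?thesis .
qed

text \<open>The gradient-tracking invariant: mixing preserves means and the gradient increments
  telescope from \<open>y 0\<close>.\<close>

lemma diging_row_mean:
  fixes f :: "'n::finite \<Rightarrow> real ^ 'p \<Rightarrow> real"
  assumes "diging f W \<alpha> x y" and W: "\<And>k. doubly_stochastic (W k)"
  shows "row_mean (y k) = row_mean (stacked_grad f (x k))"
    and "row_mean (x (Suc k)) = row_mean (x k) - \<alpha> *\<^sub>R row_mean (stacked_grad f (x k))"
proof -
  have y: "row_mean (y k) = row_mean (stacked_grad f (x k))" for k
    using assms(1)
    by (induction k)
      (simp_all add: diging_def row_mean_add row_mean_diff row_mean_stochastic_mult W)
  then show "row_mean (y k) = row_mean (stacked_grad f (x k))" .
  show "row_mean (x (Suc k)) = row_mean (x k) - \<alpha> *\<^sub>R row_mean (stacked_grad f (x k))"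
    using assms(1)
    by (simp add: diging_def row_mean_diff row_mean_scaleR row_mean_stochastic_mult W y)
qed

theorem theorem3p9:
  fixes f :: "'n::finite \<Rightarrow> real ^ 'p \<Rightarrow> real"
    and Lc mu :: "'n \<Rightarrow> real"
    and E :: "nat \<Rightarrow> ('n \<times> 'n) set"
    and W :: "nat \<Rightarrow> real ^ 'n ^ 'n"
    and B :: nat
    and L mubar kappabar \<delta> J1 :: real
  assumes differentiable: "\<And>i x. f i differentiable (at x)"
    and Lipschitz: "\<And>i x y. norm (grad (f i) x - grad (f i) y) \<le> Lc i * norm (x - y)"
    and convexity: "\<And>i x y. f i x \<ge> f i y + grad (f i) y \<bullet> (x - y) + mu i / 2 * (norm (x - y))\<^sup>2"
    and Lc_pos: "\<And>i. 0 < Lc i"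
    and mu_nonneg: "\<And>i. 0 \<le> mu i"
    and mu_pos: "\<exists>i. 0 < mu i"
    and L_eq: "L = Max (range Lc)"
    and mubar_eq: "mubar = (1 / real CARD('n)) * (\<Sum>i\<in>UNIV. mu i)"
    and kappabar_eq: "kappabar = L / mubar"
    and undirected: "\<And>k. sym (E k)"
    and W_graph: "\<And>k i j. i \<noteq> j \<Longrightarrow> (j, i) \<notin> E k \<Longrightarrow> W k $ i $ j = 0"
    and W_stochastic: "\<And>k. doubly_stochastic (W k)"
    and B_pos: "0 < B"
    and \<delta>_eq: "\<delta> = (SUP k\<in>{B - 1..}. sigma_max (back_prod W B k - averaging_matrix))"
    and \<delta>_less: "\<delta> < 1"
    and J1_eq: "J1 = 3 * kappabar * (real B)\<^sup>2 * (1 + 4 * sqrt (real CARD('n)) * sqrt kappabar)"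
  shows "\<exists>xstar. (\<forall>z. is_arg_min (avg_fun f) (\<lambda>_. True) z \<longleftrightarrow> z = xstar) \<and>
           (\<forall>\<alpha> x y. 0 < \<alpha> \<longrightarrow> \<alpha> \<le> 1.5 * (1 - \<delta>)\<^sup>2 / (mubar * J1) \<longrightarrow> diging f W \<alpha> x y \<longrightarrow>
              (\<exists>C. \<forall>k. norm (x k - (\<chi> i. xstar)) \<le> C * diging_rate B mubar \<delta> J1 \<alpha> ^ k))"
proof -
  define N where "N = real CARD('n)"
  define G where "G x = (1 / real CARD('n)) *\<^sub>R (\<Sum>i\<in>UNIV. grad (f i) x)" for x
  have N: "1 \<le> N" by (simp add: N_def Suc_le_eq)
  have deriv: "GDERIV (f i) x :> grad (f i) x" for i x
    by (rule GDERIV_grad [OF differentiable])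
  have Lc_le: "Lc i \<le> L" for i unfolding L_eq by simp
  have L: "0 < L" using Lc_pos Lc_le less_le_trans by blast
  have Lip: "norm (grad (f i) x - grad (f i) y) \<le> L * norm (x - y)" for i x y
    using Lipschitz [of i x y] mult_right_mono [OF Lc_le norm_ge_zero] order_trans by blast
  have upper: "f i y \<le> f i x + grad (f i) x \<bullet> (y - x) + L / 2 * (norm (y - x))\<^sup>2" for i x y
    by (rule Lipschitz_gradient_upper_bound [OF deriv Lip])
  have convex: "f i y \<ge> f i x + grad (f i) x \<bullet> (y - x)" for i x y
  proof -
    have "0 \<le> mu i / 2 * (norm (y - x))\<^sup>2" using mu_nonneg by simp
    then show ?thesis using convexity [of i x y] by linarith
  qed
  have "0 < sum mu UNIV"
    using mu_pos mu_nonneg by (metis UNIV_I finite sum_pos2)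
  then have mubar: "0 < mubar" by (simp add: mubar_eq)
  have mubar_le: "mubar \<le> L"
  proof -
    obtain e :: "real ^ 'p" where e: "norm e = 1"
      using vector_choose_size [of 1] by auto
    \<comment> \<open>The lower and upper quadratic bounds between 0 and a unit vector compare the
      two curvatures.\<close>
    have "mu i \<le> L" for i
      using convexity [of i 0 e] upper [of i e 0] e by simp
    then have "sum mu UNIV \<le> N * L"
      unfolding N_def using sum_bounded_above [of UNIV mu L] by simp
    then show ?thesis using N unfolding mubar_eq N_def [symmetric] by (simp add: field_simps)
  qed
  have kappa: "1 \<le> kappabar" and L_kappa: "mubar * kappabar = L"
    using mubar mubar_le by (simp_all add: kappabar_eq)
  have deriv_avg: "GDERIV (avg_fun f) x :> G x" for x
  proof -
    have "(avg_fun f has_derivative (\<lambda>h. (1 / real CARD('n)) * (\<Sum>i\<in>UNIV. h \<bullet> grad (f i) x))) (at x)"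
      unfolding avg_fun_def
      by (intro has_derivative_mult_right has_derivative_sum deriv [unfolded gderiv_def])
    then show ?thesis by (simp add: gderiv_def G_def inner_sum_right)
  qed
  have strong: "avg_fun f x \<ge> avg_fun f y + G y \<bullet> (x - y) + mubar / 2 * (norm (x - y))\<^sup>2" for x y
  proof -
    have "(\<Sum>i\<in>UNIV. f i y + grad (f i) y \<bullet> (x - y) + mu i / 2 * (norm (x - y))\<^sup>2)
        \<le> (\<Sum>i\<in>UNIV. f i x)"
      by (intro sum_mono convexity)
    then have "(1 / N) * (\<Sum>i\<in>UNIV. f i y + grad (f i) y \<bullet> (x - y) + mu i / 2 * (norm (x - y))\<^sup>2)
        \<le> avg_fun f x"
      using N unfolding avg_fun_def N_def [symmetric] by (intro mult_left_mono) auto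
    moreover have "(\<Sum>i\<in>UNIV. f i y + grad (f i) y \<bullet> (x - y) + mu i / 2 * (norm (x - y))\<^sup>2)
        = (\<Sum>i\<in>UNIV. f i y) + (\<Sum>i\<in>UNIV. grad (f i) y) \<bullet> (x - y)
          + (\<Sum>i\<in>UNIV. mu i) / 2 * (norm (x - y))\<^sup>2"
      by (simp add: sum.distrib inner_sum_left sum_divide_distrib sum_distrib_right)
    moreover have "mubar / 2 * (norm (x - y))\<^sup>2 = (1 / N) * ((\<Sum>i\<in>UNIV. mu i) / 2 * (norm (x - y))\<^sup>2)"
      by (simp add: mubar_eq N_def)
    ultimately show ?thesis
      by (simp only: avg_fun_def G_def N_def distrib_left inner_scaleR_left)
  qed
  obtain z where z: "G z = 0"
    using strongly_convex_ex_stationary [OF deriv_avg strong mubar] by blast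
  \<comment> \<open>Stationarity removes the linear term; this growth gives uniqueness of the
    minimiser and drives the contraction of the mean.\<close>
  have strong_z: "avg_fun f x \<ge> avg_fun f z + mubar / 2 * (norm (x - z))\<^sup>2" for x
    using strong [of z x] z by simp
  have unique_min: "is_arg_min (avg_fun f) (\<lambda>_. True) w \<longleftrightarrow> w = z" for w
  proof
    assume "is_arg_min (avg_fun f) (\<lambda>_. True) w"
    then have "avg_fun f w \<le> avg_fun f z" by (simp add: is_arg_min_linorder)
    then have "mubar / 2 * (norm (w - z))\<^sup>2 \<le> 0" using strong_z [of w] by linarith
    then show "w = z" using mubar by (simp add: mult_le_0_iff)
  next
    assume "w = z"
    have "avg_fun f z \<le> avg_fun f x" for x
    proof -
      have "0 \<le> mubar / 2 * (norm (x - z))\<^sup>2" using mubar by simp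
      then show ?thesis using strong_z [of x] by linarith
    qed
    with \<open>w = z\<close> show "is_arg_min (avg_fun f) (\<lambda>_. True) w"
      by (simp add: is_arg_min_linorder)
  qed
  have sigma: "sigma_max (back_prod W B k - averaging_matrix) \<le> \<delta>" if "B \<le> Suc k" for k
    unfolding \<delta>_eq using that by (intro sigma_max_back_prod_le_SUP W_stochastic) simp
  have \<delta>: "0 \<le> \<delta>"
    by (rule order_trans [OF sigma_max_nonneg sigma [of B]]) simp
  have factor: "5 \<le> 1 + 4 * sqrt N * sqrt kappabar"
    using mult_mono [of 1 "sqrt N" 1 "sqrt kappabar"] N kappa by simp
  have B: "1 \<le> (real B)\<^sup>2" using B_pos by (simp add: Suc_le_eq)
  have J1: "15 * kappabar \<le> J1"
  proof -
    have "(3 * kappabar) * (1 * 5) \<le> (3 * kappabar) * ((real B)\<^sup>2 * (1 + 4 * sqrt N * sqrt kappabar))"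
      using B factor kappa by (intro mult_left_mono mult_mono) auto
    then show ?thesis by (simp add: J1_eq N_def mult_ac)
  qed
  have "\<exists>C. \<forall>k. norm (x k - (\<chi> i. z)) \<le> C * diging_rate B mubar \<delta> J1 \<alpha> ^ k"
    if \<alpha>: "0 < \<alpha>" and \<alpha>_le: "\<alpha> \<le> 1.5 * (1 - \<delta>)\<^sup>2 / (mubar * J1)" and diging: "diging f W \<alpha> x y"
    for \<alpha> x y
  proof -
    define l where "l = diging_rate B mubar \<delta> J1 \<alpha>"
    \<comment> \<open>The step-size bound gives \<open>\<alpha> * (mubar * J1) \<le> 1.5\<close>;
      with \<open>15 * kappabar \<le> J1\<close> and \<open>mubar * kappabar = L\<close> this yields
      the limit \<open>1 / 10\<close> on \<open>\<alpha> * L\<close> that the inexact gradient step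
      requires.\<close>
    have "\<alpha> * (mubar * J1) \<le> 1.5 * (1 - \<delta>)\<^sup>2"
      using \<alpha>_le mubar J1 kappa by (simp add: pos_le_divide_eq)
    also have "\<dots> \<le> 1.5 * 1\<^sup>2"
      using \<delta> \<delta>_less by (intro mult_left_mono power_mono) auto
    finally have "\<alpha> * (mubar * J1) \<le> 1.5" by simp
    moreover have "\<alpha> * (mubar * (15 * kappabar)) \<le> \<alpha> * (mubar * J1)"
      using \<alpha> mubar J1 by (intro mult_left_mono) auto
    ultimately have \<alpha>L: "\<alpha> * L \<le> 1 / 10"
      unfolding L_kappa [symmetric] by (simp add: mult_ac)
    have \<alpha>_mubar: "\<alpha> * mubar \<le> 1 / 10"
      using mult_left_mono [OF mubar_le, of \<alpha>] \<alpha> \<alpha>L by linarith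
    have rate: "0 < l" "l \<le> 1" "\<delta> < l ^ B" "\<alpha> * mubar * J1 / 1.5 \<le> (l ^ B - \<delta>)\<^sup>2"
      "1 - \<alpha> * mubar / 1.5 \<le> l\<^sup>2"
      unfolding l_def using diging_rate_bounds [OF B_pos \<delta> \<delta>_less mubar _ \<alpha> \<alpha>_le] J1 kappa \<alpha>_mubar
      by simp_all
    define X where "X k = norm (deviation (x k))" for k
    define Y where "Y k = norm (deviation (y k))" for k
    define R where "R k = norm (row_mean (x k) - z)" for k
    \<comment> \<open>With this ratio \<open>c / \<rho>\<^sup>2\<close> is
      \<open>2 / 15 * \<alpha> * mubar\<close>, and \<open>4 / 5 - 2 / 15 = 1 / 1.5\<close> produces
      the rate of the first branch. Moreover \<open>sqrt N * \<rho> = 3 * sqrt kappabar\<close>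
      stays below the \<open>4 * sqrt N * sqrt kappabar\<close> in \<open>J1\<close>.\<close>
    define \<rho> where "\<rho> = 3 * sqrt kappabar / sqrt N"
    have dist: "norm (x k - (\<chi> i. z)) \<le> X k + sqrt N * R k" for k
      unfolding X_def R_def N_def by (rule norm_diff_const_rows_le)
    have "\<exists>C. \<forall>k. X k + sqrt N * R k \<le> C * l ^ k"
    proof (rule cyclic_recurrence_geometric_bound [where a = "1 - 4 / 5 * \<alpha> * mubar"
          and c = "6 / 5 * \<alpha> * L / N" and \<rho> = \<rho>])
      fix k assume k: "B \<le> Suc k"
      have "x (Suc k) = W k ** x k + (- \<alpha>) *\<^sub>R y k" for k
        using diging by (simp add: diging_def)
      from norm_deviation_step [of W x "\<lambda>k. (- \<alpha>) *\<^sub>R y k", OF W_stochastic this sigma [OF k] k]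
      show "X (Suc k) \<le> \<delta> * X (Suc k - B) + \<alpha> * (\<Sum>t<B. Y (k - t))"
        using \<alpha> by (simp add: X_def Y_def deviation_scaleR sum_distrib_left del: scaleR_minus_left)
      \<comment> \<open>The perturbation of \<open>y\<close> is the gradient increment; Lipschitz
        continuity and a detour via the optimum bound it by the errors of two consecutive
        iterates.\<close>
      define w where "w k = stacked_grad f (x (Suc k)) - stacked_grad f (x k)" for k
      have w: "norm (deviation (w j)) \<le> L * ((X (Suc j) + sqrt N * R (Suc j)) + (X j + sqrt N * R j))" for j
      proof -
        have "norm (deviation (w j)) \<le> norm (w j)" by (rule norm_deviation_le)
        also have "\<dots> \<le> L * norm (x (Suc j) - x j)"
          unfolding w_def using L by (intro norm_stacked_grad_diff_le Lip) simp
        also have "norm (x (Suc j) - x j) \<le> norm (x (Suc j) - (\<chi> i. z)) + norm (x j - (\<chi> i. z))"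
          using norm_triangle_ineq4 [of "x (Suc j) - (\<chi> i. z)" "x j - (\<chi> i. z)"] by simp
        also have "\<dots> \<le> (X (Suc j) + sqrt N * R (Suc j)) + (X j + sqrt N * R j)"
          by (intro add_mono dist)
        finally show ?thesis using L by simp
      qed
      have "y (Suc k) = W k ** y k + w k" for k
        using diging by (simp add: diging_def w_def)
      from norm_deviation_step [of W y w, OF W_stochastic this sigma [OF k] k]
      show "Y (Suc k) \<le> \<delta> * Y (Suc k - B)
          + (\<Sum>t<B. L * ((X (Suc (k - t)) + sqrt N * R (Suc (k - t))) + (X (k - t) + sqrt N * R (k - t))))"
        unfolding Y_def by (rule order_trans) (intro add_left_mono sum_mono w)
    next
      fix k
      have "row_mean (stacked_grad f (x k)) = (1 / real CARD('n)) *\<^sub>R (\<Sum>i\<in>UNIV. grad (f i) (x k $ i))"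
        by (simp add: row_mean_def stacked_grad_def)
      then show "(R (Suc k))\<^sup>2 \<le> (1 - 4 / 5 * \<alpha> * mubar) * (R k)\<^sup>2 + 6 / 5 * \<alpha> * L / N * (X k)\<^sup>2"
        unfolding R_def X_def N_def diging_row_mean(2) [OF diging W_stochastic]
        using inexact_gradient_step [OF upper convex Lip strong_z _ L \<alpha> \<alpha>L, of "x k"] mubar by simp
    next
      have gain: "6 / 5 * \<alpha> * L / N / \<rho>\<^sup>2 = 2 / 15 * \<alpha> * mubar"
        using N kappa unfolding L_kappa [symmetric] \<rho>_def
        by (simp add: power_divide power_mult_distrib)
      show "1 - 4 / 5 * \<alpha> * mubar + 6 / 5 * \<alpha> * L / N / \<rho>\<^sup>2 \<le> l\<^sup>2"
        unfolding gain using rate(5) by simp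
      have "sqrt N * \<rho> = 3 * sqrt kappabar" using N by (simp add: \<rho>_def)
      also have "\<dots> \<le> 4 * sqrt N * sqrt kappabar"
        using N kappa by (intro mult_right_mono) (auto intro: order_trans [of 3 4])
      finally have "2 * \<alpha> * L * (real B)\<^sup>2 * (1 + sqrt N * \<rho>)
          \<le> 2 * \<alpha> * L * (real B)\<^sup>2 * (1 + 4 * sqrt N * sqrt kappabar)"
        using \<alpha> L by (intro mult_left_mono) auto
      \<comment> \<open>The factor 3 in \<open>J1\<close> over 1.5 is the 2 of the loop gain, and
        \<open>mubar * kappabar\<close> is \<open>L\<close>.\<close>
      also have "\<dots> = \<alpha> * mubar * J1 / 1.5"
        by (simp add: J1_eq N_def L_kappa [symmetric])
      finally show "2 * \<alpha> * L * (real B)\<^sup>2 * (1 + sqrt N * \<rho>) \<le> (l ^ B - \<delta>)\<^sup>2"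
        using rate(4) by linarith
    qed (use rate B_pos \<delta> \<alpha> L N kappa \<alpha>_mubar in \<open>auto simp: X_def Y_def R_def \<rho>_def\<close>)
    then show ?thesis using dist order_trans unfolding l_def by meson
  qed
  then show ?thesis using unique_min by blast
qed

end
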